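(* Let $G=(V,E)$ be a digraph with energy $\mathcal{E}(G)$, Randić index $R(G)$ and maximum degree $\Delta(G)$. Then $\mathcal{E}(G)=2\sqrt{\Delta(G)}\,R(G)$ if and only if $G$ is a disjoint union of directed cycles $\overrightarrow{C}_n$, directed paths $\overrightarrow{P}_n$ and isolated vertices (where cycles and paths of various lengths may occur and any of the three types may be absent).
   Context: A digraph is a pair $G=(V,E)$ with $V=\{v_1,\dots,v_n\}$ a finite set and $E\subset V\times V$ such that $(v,v)\notin E$ for all $v\in V$ (both $(v,w)$ and $(w,v)$ may belong to $E$). Its adjacency matrix $A$ is the $n\times n$ matrix with $A_{ij}=1$ if $(v_i,v_j)\in E$ and $A_{ij}=0$ otherwise. The energy of $G$ is $\mathcal{E}(G)=\mathrm{Tr}((AA^t)^{1/2})=\mathrm{Tr}((A^tA)^{1/2})$, i.e. the sum of the singular values of $A$ counted with multiplicity. For $v\in V$, the outer degree is $d^+(v)=|\{w\in V:(v,w)\in E\}|$ and the inner degree is $d^-(v)=|\{w\in V:(w,v)\in E\}|$. $\Delta(G)$ is the maximum, over all vertices, of the inner and outer degrees. The Randić index of $G$ is $$R(G)=\frac{1}{2}\sum_{(v,w)\in E}\frac{1}{\sqrt{d^+(v)\,d^-(w)}}.$$ The directed path $\overrightarrow{P}_n$ has $n$ distinct vertices $v_1,\dots,v_n$ and edges exactly $(v_i,v_{i+1})$ for $1\le i\le n-1$. The directed cycle $\overrightarrow{C}_n$, $n\ge 2$, has $n$ distinct vertices $v_1,\dots,v_n$ and edges exactly $(v_i,v_{i+1})$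 for $1\le i\le n-1$ together with $(v_n,v_1)$; in particular $\overrightarrow{C}_2$ is a pair of vertices joined by arcs in both directions. *)

theory Defs
  imports
    Complex_Main
    "Graph_Theory.Pair_Digraph"
    "Jordan_Normal_Form.Matrix"
begin

text \<open>
  Finite loop-free digraphs with arc set contained in \<open>V \<times> V\<close> are the models of the locale
  \<^locale>\<open>pair_digraph\<close>; opposite arcs \<open>(v, w)\<close> and \<open>(w, v)\<close> may both be present.
  Degrees are \<^const>\<open>in_degree\<close> and \<^const>\<open>out_degree\<close> of the library.
\<close>

definition adjacency_mat :: "'a list \<Rightarrow> 'a pair_pre_digraph \<Rightarrow> real mat" where
  "adjacency_mat vs G =
     mat (length vs) (length vs) (\<lambda>(i, j). if (vs ! i, vs ! j) \<in> parcs G then 1 else 0)"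

definition mat_trace :: "real mat \<Rightarrow> real" where
  "mat_trace M = (\<Sum>i<dim_row M. M $$ (i, i))"

definition positive_semidefinite :: "real mat \<Rightarrow> bool" where
  "positive_semidefinite M \<longleftrightarrow>
     transpose_mat M = M \<and> (\<forall>x\<in>carrier_vec (dim_row M). 0 \<le> x \<bullet> (M *\<^sub>v x))"

text \<open>
  The square root \<open>M\<^bsup>1/2\<^esup>\<close> in the sense of functional calculus. It exists and is unique whenever
  \<open>M\<close> is positive semidefinite, as is the case for every matrix of the form \<open>A A\<^sup>T\<close>.
\<close>

definition psd_sqrt :: "real mat \<Rightarrow> real mat" where
  "psd_sqrt M =
     (THE B. B \<in> carrier_mat (dim_row M) (dim_row M) \<and> positive_semidefinite B \<and> B * B = M)"

text \<open>
  The list \<open>vs\<close> enumerates the vertices without repetition and so fixes the order of the rows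
  and columns of the adjacency matrix; the value does not depend on this order.
\<close>

definition energy :: "'a list \<Rightarrow> 'a pair_pre_digraph \<Rightarrow> real" where
  "energy vs G = mat_trace (psd_sqrt (adjacency_mat vs G * transpose_mat (adjacency_mat vs G)))"

text \<open>
  On the digraph without vertices the maximum below is unspecified, but there the
  Randic index is \<open>0\<close>, so \<open>sqrt (max_degree G) * randic_index G\<close> is still determined.
\<close>

definition max_degree :: "'a pair_pre_digraph \<Rightarrow> nat" where
  "max_degree G =
     Max (in_degree (with_proj G) ` pverts G \<union> out_degree (with_proj G) ` pverts G)"

definition randic_index :: "'a pair_pre_digraph \<Rightarrow> real" where
  "randic_index G =
     1 / 2 * (\<Sum>(v, w)\<in>parcs G.
       1 / sqrt (real (out_degree (with_proj G) v) * real (in_degree (with_proj G) w)))"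

definition consecutive_pairs :: "'a list \<Rightarrow> ('a \<times> 'a) set" where
  "consecutive_pairs vs = {(vs ! i, vs ! Suc i) | i. Suc i < length vs}"

text \<open>A path with a single vertex is allowed; it coincides with an isolated vertex.\<close>

definition is_directed_path :: "'a pair_pre_digraph \<Rightarrow> bool" where
  "is_directed_path H \<longleftrightarrow>
     (\<exists>vs. vs \<noteq> [] \<and> distinct vs \<and> pverts H = set vs \<and> parcs H = consecutive_pairs vs)"

definition is_directed_cycle :: "'a pair_pre_digraph \<Rightarrow> bool" where
  "is_directed_cycle H \<longleftrightarrow>
     (\<exists>vs. 2 \<le> length vs \<and> distinct vs \<and> pverts H = set vs \<and>
        parcs H = consecutive_pairs vs \<union> {(last vs, hd vs)})"

definition is_isolated_vertex :: "'a pair_pre_digraph \<Rightarrow> bool" where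
  "is_isolated_vertex H \<longleftrightarrow> (\<exists>v. pverts H = {v} \<and> parcs H = {})"

definition is_disjoint_union :: "'a pair_pre_digraph \<Rightarrow> 'a pair_pre_digraph set \<Rightarrow> bool" where
  "is_disjoint_union G \<H> \<longleftrightarrow>
     pairwise (\<lambda>H K. disjnt (pverts H) (pverts K)) \<H> \<and>
     pverts G = (\<Union>H\<in>\<H>. pverts H) \<and>
     parcs G = (\<Union>H\<in>\<H>. parcs H)"

end

theory Submission
  imports Defs "HOL-Analysis.Function_Topology"
begin

text \<open>
  Put \<open>M = A A\<^sup>T\<close> and \<open>B = M\<^bsup>1/2\<^esup>\<close>. Since \<open>M\<^sub>i\<^sub>i = \<Sum>\<^sub>k (B\<^sub>i\<^sub>k)\<^sup>2\<close> is the outer degree of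
  the \<open>i\<close>-th vertex, the trace of \<open>B\<close> is at most \<open>\<Sum>\<^sub>v sqrt (d\<^sup>+ v)\<close>, which is the sum of
  \<open>1 / sqrt (d\<^sup>+ v)\<close> over the arcs \<open>(v, w)\<close> and hence, as \<open>d\<^sup>- w \<le> \<Delta>\<close>, at most
  \<open>2 sqrt \<Delta> R\<close>. Equality in the first step makes \<open>B\<close> and therefore \<open>M\<close> diagonal, so that no two
  vertices have a common out-neighbour; equality in the second step gives
  \<open>\<Delta> = d\<^sup>- w = 1\<close> as soon as there is an arc. Conversely, if all degrees
  are at most \<open>1\<close>, then \<open>M\<close> is an idempotent diagonal matrix, hence its own square root. The digraphs with all degrees at most \<open>1\<close> are the
  disjoint unions of directed cycles, directed paths and isolated vertices.
\<close>

subsection \<open>Square roots of positive semidefinite matrices\<close>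

lemma mat_trace_comm:
  assumes "A \<in> carrier_mat n m" "B \<in> carrier_mat m n"
  shows "mat_trace (A * B) = mat_trace (B * A)"
proof -
  have "mat_trace (A * B) = (\<Sum>i<n. \<Sum>j<m. A $$ (i, j) * B $$ (j, i))"
    using assms by (auto simp: mat_trace_def scalar_prod_def lessThan_atLeast0)
  also have "\<dots> = (\<Sum>j<m. \<Sum>i<n. B $$ (j, i) * A $$ (i, j))"
    by (subst sum.swap) (simp add: mult.commute)
  also have "\<dots> = mat_trace (B * A)"
    using assms by (auto simp: mat_trace_def scalar_prod_def lessThan_atLeast0)
  finally show ?thesis .
qed

lemma scalar_prod_self_eq_0:
  fixes v :: "real vec"
  assumes "v \<in> carrier_vec n" "v \<bullet> v = 0"
  shows "v = 0\<^sub>v n"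
  using conjugate_square_eq_0_vec[of v n] assms by (simp add: vec_eq_iff scalar_prod_def)

lemma symmetric_scalar_prod:
  fixes B :: "real mat"
  assumes "B \<in> carrier_mat n n" "transpose_mat B = B" "x \<in> carrier_vec n" "y \<in> carrier_vec n"
  shows "x \<bullet> (B *\<^sub>v y) = (B *\<^sub>v x) \<bullet> y"
  using transpose_vec_mult_scalar[of B n n y x] assms by (simp add: comm_scalar_prod[of _ n])

text \<open>A zero \<open>y\<close> of a nonnegative quadratic form is a minimum, so moving from
  \<open>y\<close> in the direction \<open>z = B *\<^sub>v y\<close> must not make the form
  negative. Its value at \<open>y + t z\<close> is \<open>2 * t * s + t\<^sup>2 * c\<close> with
  \<open>s = z \<bullet> z\<close>, which is negative for small \<open>t < 0\<close> unless
  \<open>s = 0\<close>.\<close>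

lemma psd_quadratic_form_eq_0:
  assumes B: "B \<in> carrier_mat n n" "positive_semidefinite B"
    and y: "y \<in> carrier_vec n" and zero: "y \<bullet> (B *\<^sub>v y) = 0"
  shows "B *\<^sub>v y = 0\<^sub>v n"
proof -
  define z where "z = B *\<^sub>v y"
  define c where "c = z \<bullet> (B *\<^sub>v z)"
  define s where "s = z \<bullet> z"
  have z: "z \<in> carrier_vec n" using B y by (simp add: z_def)
  have Bz: "B *\<^sub>v z \<in> carrier_vec n" using B z by simp
  have sym: "transpose_mat B = B" and nonneg: "\<And>x. x \<in> carrier_vec n \<Longrightarrow> 0 \<le> x \<bullet> (B *\<^sub>v x)"
    using B by (auto simp: positive_semidefinite_def)
  have c0: "c \<ge> 0" using nonneg z by (simp add: c_def)
  have "y \<bullet> (B *\<^sub>v z) = s"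
    using symmetric_scalar_prod[OF B(1) sym y z] by (simp add: s_def z_def)
  moreover have "z \<bullet> (B *\<^sub>v y) = s" by (simp add: s_def z_def)
  ultimately have form: "(y + t \<cdot>\<^sub>v z) \<bullet> (B *\<^sub>v (y + t \<cdot>\<^sub>v z)) = 2 * t * s + t\<^sup>2 * c" for t
  proof -
    have "B *\<^sub>v (y + t \<cdot>\<^sub>v z) = B *\<^sub>v y + t \<cdot>\<^sub>v (B *\<^sub>v z)"
      using B y z by (simp add: mult_add_distrib_mat_vec[of _ n n] mult_mat_vec[of _ n n])
    then show ?thesis
      using B y z Bz zero \<open>y \<bullet> (B *\<^sub>v z) = s\<close> \<open>z \<bullet> (B *\<^sub>v y) = s\<close>
      by (simp add: add_scalar_prod_distrib[of _ n] scalar_prod_add_distrib[of _ n]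
          c_def power2_eq_square algebra_simps)
  qed
  \<comment> \<open>This \<open>t\<close> minimises \<open>2 * t * s + t\<^sup>2 * (c + 1)\<close>.
    Passing from \<open>c\<close> to \<open>c + 1\<close> keeps the denominator positive even if
    \<open>c = 0\<close>.\<close>
  define t where "t = - s / (c + 1)"
  have "0 \<le> 2 * t * s + t\<^sup>2 * c"
    using nonneg[of "y + t \<cdot>\<^sub>v z"] y z form by simp
  also have "\<dots> \<le> 2 * t * s + t\<^sup>2 * (c + 1)" by (simp add: algebra_simps)
  also have "\<dots> = - (s\<^sup>2 / (c + 1))"
  proof -
    have "t * (c + 1) = - s" using c0 by (simp add: t_def)
    then have "t\<^sup>2 * (c + 1) = - t * s" by (simp add: power2_eq_square algebra_simps)
    moreover have "t * s = - (s\<^sup>2 / (c + 1))" by (simp add: t_def power2_eq_square)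
    ultimately show ?thesis by simp
  qed
  finally have "s\<^sup>2 / (c + 1) \<le> 0" by simp
  with c0 have "s = 0" by (simp add: divide_le_0_iff)
  then show ?thesis using scalar_prod_self_eq_0[OF z] by (simp add: s_def z_def)
qed

text \<open>By symmetry the diagonal of \<open>D * D\<close> holds the squared lengths of the rows
  of \<open>D\<close>.\<close>

lemma symmetric_square_eq_0:
  fixes D :: "real mat"
  assumes D: "D \<in> carrier_mat n n" "transpose_mat D = D" "D * D = 0\<^sub>m n n"
  shows "D = 0\<^sub>m n n"
proof -
  have row: "row D i = 0\<^sub>v n" if "i < n" for i
  proof -
    have "(D * D) $$ (i, i) = row D i \<bullet> col D i"
      using D(1) that by (simp only: index_mult_mat carrier_matD)
    also have "col D i = row D i"
      using D that row_transpose[of i D] by simp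
    finally have "row D i \<bullet> row D i = 0" using D that by simp
    then show ?thesis using D that by (intro scalar_prod_self_eq_0) auto
  qed
  show ?thesis
  proof (rule eq_matI)
    fix i j assume "i < dim_row (0\<^sub>m n n :: real mat)" "j < dim_col (0\<^sub>m n n :: real mat)"
    then show "D $$ (i, j) = 0\<^sub>m n n $$ (i, j)"
      using row[of i] D by (metis index_row(1) index_zero_mat carrier_matD index_zero_vec(1))
  qed (use D in auto)
qed

text \<open>Since \<open>D\<close> is symmetric, the diagonal entries of \<open>D * B * D\<close>
  are the values of the quadratic form of \<open>B\<close> at the columns of \<open>D\<close>. If
  these nonnegative numbers add up to zero, each of them vanishes, and
  \<open>psd_quadratic_form_eq_0\<close> shows that \<open>B\<close> annihilates every column of
  \<open>D\<close>.\<close>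

lemma psd_sandwich:
  assumes B: "B \<in> carrier_mat n n" "positive_semidefinite B"
    and D: "D \<in> carrier_mat n n" "transpose_mat D = D"
  shows "mat_trace (D * B * D) \<ge> 0"
    and "mat_trace (D * B * D) = 0 \<Longrightarrow> B * D = 0\<^sub>m n n"
proof -
  have tr: "mat_trace (D * B * D) = (\<Sum>i<n. col D i \<bullet> (B *\<^sub>v col D i))"
  proof -
    have "(D * B * D) $$ (i, i) = col D i \<bullet> (B *\<^sub>v col D i)" if "i < n" for i
    proof -
      have "(D * B * D) $$ (i, i) = (D * (B * D)) $$ (i, i)" using B D by simp
      also have "\<dots> = row D i \<bullet> col (B * D) i" using B D that by simp
      also have "col (B * D) i = B *\<^sub>v col D i" using B D that by (intro eq_vecI) auto
      also have "row D i = col D i" using D that col_transpose[of i D] by simp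
      finally show ?thesis .
    qed
    then show ?thesis using D by (simp add: mat_trace_def)
  qed
  have nonneg: "col D i \<bullet> (B *\<^sub>v col D i) \<ge> 0" if "i < n" for i
    using B D that by (auto simp: positive_semidefinite_def)
  show "mat_trace (D * B * D) \<ge> 0"
    unfolding tr by (intro sum_nonneg) (simp add: nonneg)
  assume "mat_trace (D * B * D) = 0"
  then have "col D i \<bullet> (B *\<^sub>v col D i) = 0" if "i < n" for i
    using that nonneg unfolding tr by (subst (asm) sum_nonneg_eq_0_iff) auto
  then have col: "B *\<^sub>v col D i = 0\<^sub>v n" if "i < n" for i
    using psd_quadratic_form_eq_0[OF B] D that by simp
  show "B * D = 0\<^sub>m n n"
  proof (rule eq_matI)
    fix i j assume "i < dim_row (0\<^sub>m n n :: real mat)" "j < dim_col (0\<^sub>m n n :: real mat)"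
    then show "(B * D) $$ (i, j) = 0\<^sub>m n n $$ (i, j)"
      using col[of j] B D index_mult_mat_vec[of i B "col D j"] by simp
  qed (use B D in auto)
qed

text \<open>With \<open>D = B - C\<close> one has \<open>B D = - D C\<close>, so the nonnegative traces of \<open>D B D\<close> and \<open>D C D\<close>
  are opposite and both vanish.\<close>

lemma psd_square_root_unique:
  assumes B: "B \<in> carrier_mat n n" "positive_semidefinite B"
    and C: "C \<in> carrier_mat n n" "positive_semidefinite C"
    and eq: "B * B = C * C"
  shows "B = C"
proof -
  define D where "D = B - C"
  have D: "D \<in> carrier_mat n n" using B C by (simp add: D_def minus_carrier_mat)
  have "transpose_mat D = D"
    using B C by (simp add: D_def transpose_minus[of _ n n] positive_semidefinite_def)
  note D = D this
  have BD: "B * D = C * C - B * C" and DC: "D * C = B * C - C * C"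
    unfolding D_def using B C eq
    by (simp_all add: mult_minus_distrib_mat[of _ n n] minus_mult_distrib_mat[of _ n n])
  have "B * D = - (D * C)"
    unfolding BD DC using B C by (intro eq_matI) auto
  then have "D * B * D = - (D * D * C)"
    using B C D by simp
  then have "mat_trace (D * B * D) = - mat_trace (D * (D * C))"
    using B C D by (simp add: mat_trace_def sum_negf)
  also have "mat_trace (D * (D * C)) = mat_trace (D * C * D)"
    using C D by (intro mat_trace_comm[of _ n n]) auto
  finally have "mat_trace (D * B * D) = 0" "mat_trace (D * C * D) = 0"
    using psd_sandwich(1)[OF B D] psd_sandwich(1)[OF C D] by auto
  then have "B * D = 0\<^sub>m n n" "C * D = 0\<^sub>m n n"
    using psd_sandwich(2)[OF B D] psd_sandwich(2)[OF C D] by auto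
  \<comment> \<open>Here \<open>D * D = B * D - C * D\<close>, and a symmetric matrix whose square
    is zero vanishes.\<close>
  then have "D * D = 0\<^sub>m n n"
    using B C D unfolding D_def by (simp add: minus_mult_distrib_mat[of _ n n])
  then have "D = 0\<^sub>m n n" using D by (auto intro: symmetric_square_eq_0[of D n])
  then have "B $$ (i, j) = C $$ (i, j)" if "i < n" "j < n" for i j
    using that B C index_minus_mat(1)[of i C j B] by (simp add: D_def)
  then show ?thesis using B C by (intro eq_matI) auto
qed

section \<open>Existence of the square root from a trace maximum over the orthogonal group\<close>

lemma orthogonal_mat_entries:
  fixes R :: "real mat"
  assumes "R \<in> carrier_mat n n"
  shows "R * transpose_mat R = 1\<^sub>m n \<longleftrightarrow>
    (\<forall>i<n. \<forall>j<n. (\<Sum>m<n. R $$ (i, m) * R $$ (j, m)) = (if i = j then 1 else 0))"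
proof -
  have entry: "(R * transpose_mat R) $$ (i, j) = (\<Sum>m<n. R $$ (i, m) * R $$ (j, m))"
    if "i < n" "j < n" for i j
    using assms that by (simp add: scalar_prod_def lessThan_atLeast0)
  show ?thesis
  proof
    assume "R * transpose_mat R = 1\<^sub>m n"
    then show "\<forall>i<n. \<forall>j<n. (\<Sum>m<n. R $$ (i, m) * R $$ (j, m)) = (if i = j then 1 else 0)"
      using entry by (metis index_one_mat(1))
  next
    assume "\<forall>i<n. \<forall>j<n. (\<Sum>m<n. R $$ (i, m) * R $$ (j, m)) = (if i = j then 1 else 0)"
    then show "R * transpose_mat R = 1\<^sub>m n"
      using assms entry by (intro eq_matI) auto
  qed
qed

text \<open>The rows are unit vectors. The bound places the orthogonal matrices inside a cube, which
  yields compactness below.\<close>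

lemma orthogonal_mat_entry_bound:
  fixes R :: "real mat"
  assumes "R \<in> carrier_mat n n" "R * transpose_mat R = 1\<^sub>m n" "i < n" "j < n"
  shows "\<bar>R $$ (i, j)\<bar> \<le> 1"
proof -
  have "(R $$ (i, j))\<^sup>2 \<le> (\<Sum>m<n. (R $$ (i, m))\<^sup>2)"
    using assms(4) by (intro member_le_sum) auto
  also have "\<dots> = 1"
    using assms orthogonal_mat_entries[of R n] by (simp add: power2_eq_square)
  finally show ?thesis by (simp add: abs_square_le_1)
qed

text \<open>The orthogonal matrices form a closed subset of a product of compact intervals, and the
  trace is continuous in the entries, so a maximum is attained.\<close>

lemma trace_mult_orthogonal_attains_max:
  fixes A :: "real mat"
  assumes A: "A \<in> carrier_mat n n"
  obtains Q where "Q \<in> carrier_mat n n" "Q * transpose_mat Q = 1\<^sub>m n"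
    "\<And>R. R \<in> carrier_mat n n \<Longrightarrow> R * transpose_mat R = 1\<^sub>m n \<Longrightarrow>
      mat_trace (A * R) \<le> mat_trace (A * Q)"
proof -
  \<comment> \<open>Matrices are represented by functions on all index pairs, which carry the
    product topology. Coordinates outside the \<open>n\<close> by \<open>n\<close> block are merely
    confined to \<open>{-1..1}\<close>; neither the orthogonality equations nor \<open>T\<close>
    depend on them.\<close>
  define S :: "(nat \<times> nat \<Rightarrow> real) set" where
    "S = PiE UNIV (\<lambda>_. {-1..1}) \<inter> (\<Inter>i\<in>{..<n}. \<Inter>j\<in>{..<n}.
      {f. (\<Sum>m<n. f (i, m) * f (j, m)) = (if i = j then 1 else 0)})"
  define T :: "(nat \<times> nat \<Rightarrow> real) \<Rightarrow> real" where
    "T f = (\<Sum>i<n. \<Sum>m<n. A $$ (i, m) * f (m, i))" for f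
  have T: "mat_trace (A * mat n n f) = T f" for f
    using A by (auto simp: mat_trace_def T_def scalar_prod_def lessThan_atLeast0)
  have S: "f \<in> S \<longleftrightarrow> (\<forall>p. f p \<in> {-1..1}) \<and> mat n n f * transpose_mat (mat n n f) = 1\<^sub>m n" for f
    by (subst orthogonal_mat_entries[of _ n]) (auto simp: S_def)
  have "compact (PiE UNIV (\<lambda>_. {-1..1}) :: (nat \<times> nat \<Rightarrow> real) set)"
    using compactin_PiE[of "\<lambda>_. euclidean" UNIV "\<lambda>_::nat \<times> nat. {-1..1::real}"]
    by (simp add: euclidean_product_topology)
  then have "compact S"
    unfolding S_def
    by (intro compact_Int_closed closed_INT ballI closed_Collect_eq continuous_intros
        continuous_on_product_coordinates)
  moreover have "(\<lambda>(i, j). if i = j then 1 else 0) \<in> S"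
  proof -
    have "mat n n (\<lambda>(i, j). if i = j then 1 else 0) = (1\<^sub>m n :: real mat)"
      by (intro eq_matI) auto
    then show ?thesis unfolding S by auto
  qed
  then have "S \<noteq> {}" by blast
  moreover have "continuous_on S T"
    unfolding T_def
    by (intro continuous_intros continuous_on_subset[OF continuous_on_product_coordinates]) auto
  ultimately obtain f where f: "f \<in> S" "\<And>g. g \<in> S \<Longrightarrow> T g \<le> T f"
    using continuous_attains_sup[of S T] by blast
  show thesis
  proof (rule that[of "mat n n f"])
    show "mat n n f * transpose_mat (mat n n f) = 1\<^sub>m n" using f(1) S by blast
    fix R :: "real mat" assume R: "R \<in> carrier_mat n n" "R * transpose_mat R = 1\<^sub>m n"
    \<comment> \<open>Extension by \<open>0\<close> keeps the coordinates outside the block within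
      \<open>{-1..1}\<close>.\<close>
    define g where "g = (\<lambda>(i, j). if i < n \<and> j < n then R $$ (i, j) else 0)"
    have gR: "mat n n g = R" using R(1) by (intro eq_matI) (auto simp: g_def)
    have "g p \<in> {-1..1}" for p
      using orthogonal_mat_entry_bound[OF R] by (cases p) (auto simp: g_def abs_le_iff)
    then have "g \<in> S" using gR R(2) by (simp add: S)
    then show "mat_trace (A * R) \<le> mat_trace (A * mat n n f)"
      using f(2) T[of g] T[of f] gR by simp
  qed simp
qed

lemma quadratic_form_sum:
  fixes B :: "real mat"
  assumes "B \<in> carrier_mat n n" "v \<in> carrier_vec n"
  shows "v \<bullet> (B *\<^sub>v v) = (\<Sum>i<n. \<Sum>j<n. v $ i * B $$ (i, j) * v $ j)"
proof -
  have "v \<bullet> (B *\<^sub>v v) = (\<Sum>i<n. v $ i * (\<Sum>j<n. B $$ (i, j) * v $ j))"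
    using assms by (simp add: scalar_prod_def lessThan_atLeast0)
  then show ?thesis by (simp add: sum_distrib_left mult.assoc)
qed

text \<open>The competitor for \<open>v \<noteq> 0\<close> is the Householder reflection
  \<open>R\<close> in the hyperplane orthogonal to \<open>v\<close>. Multiplying \<open>B\<close> by
  it changes the trace by \<open>- 2 / s * (v \<bullet> (B *\<^sub>v v))\<close>, and by maximality
  this change is not positive.\<close>

lemma max_trace_imp_psd_form:
  fixes B :: "real mat"
  assumes B: "B \<in> carrier_mat n n"
    and max: "\<And>R. R \<in> carrier_mat n n \<Longrightarrow> R * transpose_mat R = 1\<^sub>m n \<Longrightarrow>
      mat_trace (B * R) \<le> mat_trace B"
    and v: "v \<in> carrier_vec n"
  shows "0 \<le> v \<bullet> (B *\<^sub>v v)"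
proof -
  define s where "s = v \<bullet> v"
  have s: "s = (\<Sum>m<n. v $ m * v $ m)"
    using v by (simp add: s_def scalar_prod_def lessThan_atLeast0)
  have s0: "s \<ge> 0" unfolding s by (intro sum_nonneg) simp
  show ?thesis
  proof (cases "s = 0")
    case True
    then have "v = 0\<^sub>v n" using scalar_prod_self_eq_0[OF v] by (simp add: s_def)
    then show ?thesis using B by simp
  next
    case False
    with s0 have spos: "s > 0" by simp
    define R where "R = mat n n (\<lambda>(i, j). (if i = j then 1 else 0) - 2 / s * v $ i * v $ j)"
    have R: "R \<in> carrier_mat n n" by (simp add: R_def)
    have "(\<Sum>m<n. R $$ (i, m) * R $$ (j, m)) = (if i = j then 1 else 0)"
      if ij: "i < n" "j < n" for i j
    proof -
      \<comment> \<open>Every Kronecker delta becomes a condition on the summation index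
        \<open>m\<close>, so that each sum collapses. The two cross terms are then cancelled by the
        last one, because \<open>(2 / s)\<^sup>2 * s = 4 / s\<close>.\<close>
      have "(\<Sum>m<n. R $$ (i, m) * R $$ (j, m)) =
        (\<Sum>m<n. (if m = i then (if i = j then 1 else 0) else 0)
          - (if m = i then 2 / s * v $ j * v $ m else 0)
          - (if m = j then 2 / s * v $ i * v $ m else 0)
          + (2 / s)\<^sup>2 * v $ i * v $ j * (v $ m * v $ m))"
        using ij by (intro sum.cong) (auto simp: R_def algebra_simps power2_eq_square)
      also have "\<dots> = (if i = j then 1 else 0) - 2 / s * v $ j * v $ i - 2 / s * v $ i * v $ j
          + (2 / s)\<^sup>2 * v $ i * v $ j * s"
        using ij by (simp add: sum.distrib sum_subtractf s sum_distrib_left)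
      also have "(2 / s)\<^sup>2 * v $ i * v $ j * s = 4 / s * v $ i * v $ j"
        using False by (simp add: power2_eq_square field_simps)
      finally show ?thesis by (simp add: algebra_simps)
    qed
    then have "R * transpose_mat R = 1\<^sub>m n" using orthogonal_mat_entries[OF R] by simp
    with max R have "mat_trace (B * R) \<le> mat_trace B" by blast
    moreover have "mat_trace (B * R) = mat_trace B - 2 / s * (v \<bullet> (B *\<^sub>v v))"
    proof -
      have "mat_trace (B * R) = (\<Sum>i<n. \<Sum>m<n. B $$ (i, m) * R $$ (m, i))"
        using B R by (auto simp: mat_trace_def scalar_prod_def lessThan_atLeast0)
      also have "\<dots> = (\<Sum>i<n. \<Sum>m<n. (if m = i then B $$ (i, m) else 0)
          - 2 / s * (v $ i * B $$ (i, m) * v $ m))"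
        by (intro sum.cong refl) (auto simp: R_def algebra_simps)
      also have "\<dots> = (\<Sum>i<n. B $$ (i, i)) - 2 / s * (v \<bullet> (B *\<^sub>v v))"
        unfolding quadratic_form_sum[OF B v] by (simp add: sum_subtractf sum_distrib_left)
      finally show ?thesis using B by (simp add: mat_trace_def)
    qed
    ultimately have "2 / s * (v \<bullet> (B *\<^sub>v v)) \<ge> 0" by simp
    then show ?thesis using spos by (simp add: zero_le_divide_iff)
  qed
qed

text \<open>The competitors are the rotations of the coordinate plane of \<open>p\<close> and
  \<open>q\<close>. With cosine \<open>c\<close> and sine \<open>s\<close> they change the trace by
  \<open>a * c + b * s - a\<close>. On the unit circle \<open>a * c + b * s\<close> reaches
  \<open>sqrt (a\<^sup>2 + b\<^sup>2)\<close>, which exceeds \<open>a\<close> unless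
  \<open>b = 0\<close>.\<close>

lemma max_trace_imp_symmetric:
  fixes B :: "real mat"
  assumes B: "B \<in> carrier_mat n n"
    and max: "\<And>R. R \<in> carrier_mat n n \<Longrightarrow> R * transpose_mat R = 1\<^sub>m n \<Longrightarrow>
      mat_trace (B * R) \<le> mat_trace B"
    and pq: "p < n" "q < n" "p \<noteq> q"
  shows "B $$ (p, q) = B $$ (q, p)"
proof -
  define a where "a = B $$ (p, p) + B $$ (q, q)"
  define b where "b = B $$ (q, p) - B $$ (p, q)"
  define r where "r = sqrt (a\<^sup>2 + b\<^sup>2)"
  have rot: "a * c + b * s \<le> a" if cs: "c\<^sup>2 + s\<^sup>2 = 1" for c s
  proof -
    define R where "R = mat n n (\<lambda>(i, j).
      if i = p then (if j = p then c else 0) + (if j = q then s else 0)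
      else if i = q then (if j = q then c else 0) - (if j = p then s else 0)
      else if i = j then 1 else 0)"
    have R: "R \<in> carrier_mat n n" by (simp add: R_def)
    have Rpm: "R $$ (p, m) = (if m = p then c else 0) + (if m = q then s else 0)"
      and Rqm: "R $$ (q, m) = (if m = q then c else 0) - (if m = p then s else 0)"
      and Rim: "i < n \<Longrightarrow> i \<noteq> p \<Longrightarrow> i \<noteq> q \<Longrightarrow> R $$ (i, m) = (if m = i then 1 else 0)"
      if "m < n" for i m
      using that pq by (auto simp: R_def)
    \<comment> \<open>Multiplication by \<open>R\<close> from the left mixes only the entries
      \<open>p\<close> and \<open>q\<close>. This is applied with \<open>f\<close> a row of
      \<open>R\<close>, for orthogonality, and with \<open>f\<close> a column of \<open>B\<close>,
      for the trace.\<close>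
    have inner: "(\<Sum>m<n. R $$ (i, m) * f m) =
      (if i = p then c * f p + s * f q else if i = q then c * f q - s * f p else f i)"
      if "i < n" for i and f :: "nat \<Rightarrow> real"
    proof -
      consider "i = p" | "i = q" "i \<noteq> p" | "i \<noteq> p" "i \<noteq> q" by blast
      then show ?thesis
      proof cases
        case 1
        have "(\<Sum>m<n. R $$ (p, m) * f m) =
          (\<Sum>m<n. (if m = p then c * f m else 0) + (if m = q then s * f m else 0))"
          by (intro sum.cong refl) (simp add: Rpm distrib_right)
        then show ?thesis using pq 1 by (simp add: sum.distrib)
      next
        case 2
        have "(\<Sum>m<n. R $$ (q, m) * f m) =
          (\<Sum>m<n. (if m = q then c * f m else 0) - (if m = p then s * f m else 0))"
          by (intro sum.cong refl) (simp add: Rqm left_diff_distrib)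
        then show ?thesis using pq 2 by (simp add: sum_subtractf)
      next
        case 3
        have "(\<Sum>m<n. R $$ (i, m) * f m) = (\<Sum>m<n. if m = i then f m else 0)"
          by (intro sum.cong refl) (simp add: Rim[OF _ that 3])
        then show ?thesis using that 3 by simp
      qed
    qed
    have "(\<Sum>m<n. R $$ (i, m) * R $$ (j, m)) = (if i = j then 1 else 0)"
      if ij: "i < n" "j < n" for i j
    proof -
      have "R $$ (j, m) = (if j = p then (if m = p then c else 0) + (if m = q then s else 0)
        else if j = q then (if m = q then c else 0) - (if m = p then s else 0)
        else if m = j then 1 else 0)" if "m < n" for m
        using that ij Rpm Rqm Rim by simp
      then show ?thesis
        unfolding inner[OF ij(1)] using ij pq cs
        by (simp add: power2_eq_square add.commute)
    qed
    then have "R * transpose_mat R = 1\<^sub>m n" using orthogonal_mat_entries[OF R] by simp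
    with max R have "mat_trace (B * R) \<le> mat_trace B" by blast
    moreover have "mat_trace (B * R) = mat_trace (R * B)"
      using B R by (intro mat_trace_comm)
    moreover have "mat_trace (R * B) = (\<Sum>i<n. if i = p then c * B $$ (p, p) + s * B $$ (q, p)
      else if i = q then c * B $$ (q, q) - s * B $$ (p, q) else B $$ (i, i))"
    proof -
      have "mat_trace (R * B) = (\<Sum>i<n. \<Sum>m<n. R $$ (i, m) * B $$ (m, i))"
        using B R by (auto simp: mat_trace_def scalar_prod_def lessThan_atLeast0)
      also have "\<dots> = (\<Sum>i<n. if i = p then c * B $$ (p, p) + s * B $$ (q, p)
        else if i = q then c * B $$ (q, q) - s * B $$ (p, q) else B $$ (i, i))"
        by (intro sum.cong refl) (simp add: inner)
      finally show ?thesis .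
    qed
    moreover have "\<dots> = (\<Sum>i<n. B $$ (i, i)
      + ((if i = p then c * B $$ (p, p) + s * B $$ (q, p) - B $$ (p, p) else 0)
      + (if i = q then c * B $$ (q, q) - s * B $$ (p, q) - B $$ (q, q) else 0)))"
      using pq by (intro sum.cong) auto
    moreover have "\<dots> = mat_trace B + (a * c + b * s - a)"
      using pq B by (simp add: sum.distrib a_def b_def mat_trace_def algebra_simps)
    ultimately show ?thesis by simp
  qed
  have "b = 0"
  proof (rule ccontr)
    assume "b \<noteq> 0"
    then have "a\<^sup>2 < a\<^sup>2 + b\<^sup>2" "0 < a\<^sup>2 + b\<^sup>2"
      by (auto simp: add_nonneg_pos)
    then have r: "r > 0" "r\<^sup>2 = a\<^sup>2 + b\<^sup>2" by (auto simp: r_def)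
    \<comment> \<open>The point \<open>(a, b) / r\<close> of the unit circle is where
      \<open>a * c + b * s\<close> is largest, with value \<open>r\<close>.\<close>
    have "(a / r)\<^sup>2 + (b / r)\<^sup>2 = 1"
      using r(1) by (simp add: power_divide r(2)[symmetric] flip: add_divide_distrib)
    then have "a * (a / r) + b * (b / r) \<le> a" by (rule rot)
    moreover have "a * (a / r) + b * (b / r) = r"
      using r by (simp add: power2_eq_square field_simps)
    ultimately have "r \<le> a" by simp
    then have "r\<^sup>2 \<le> a\<^sup>2" using r by (intro power_mono) auto
    with r \<open>a\<^sup>2 < a\<^sup>2 + b\<^sup>2\<close> show False by simp
  qed
  then show ?thesis by (simp add: b_def)
qed

text \<open>An orthogonal \<open>Q\<close> that maximises the trace of \<open>A Q\<close> makes \<open>A Q\<close> symmetric positive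
  semidefinite (compare with \<open>Q\<close> times a rotation or a reflection), and
  \<open>A Q (A Q)\<^sup>T = A A\<^sup>T\<close>.\<close>

lemma psd_square_root_exists:
  fixes A :: "real mat"
  assumes A: "A \<in> carrier_mat n n"
  obtains B where "B \<in> carrier_mat n n" "positive_semidefinite B" "B * B = A * transpose_mat A"
proof -
  obtain Q where Q: "Q \<in> carrier_mat n n" "Q * transpose_mat Q = 1\<^sub>m n"
    "\<And>R. R \<in> carrier_mat n n \<Longrightarrow> R * transpose_mat R = 1\<^sub>m n \<Longrightarrow>
      mat_trace (A * R) \<le> mat_trace (A * Q)"
    using trace_mult_orthogonal_attains_max[OF A] by blast
  define B where "B = A * Q"
  have B: "B \<in> carrier_mat n n" using A Q by (simp add: B_def)
  \<comment> \<open>Orthogonal matrices are closed under products, so the maximality of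
    \<open>Q\<close> for \<open>A\<close> turns into that of the identity for
    \<open>A * Q\<close>.\<close>
  have max: "mat_trace (B * R) \<le> mat_trace B"
    if R: "R \<in> carrier_mat n n" "R * transpose_mat R = 1\<^sub>m n" for R
  proof -
    have "(Q * R) * transpose_mat (Q * R) = Q * (R * transpose_mat R) * transpose_mat Q"
      using Q(1) R(1) by (simp add: transpose_mult[of _ n n] assoc_mult_mat[of _ n n _ n _ n])
    also have "\<dots> = 1\<^sub>m n" using Q R by simp
    finally have "mat_trace (A * (Q * R)) \<le> mat_trace B"
      unfolding B_def using Q R by (intro Q(3)) auto
    then show ?thesis using A Q R by (simp add: B_def)
  qed
  have entry: "B $$ (i, j) = B $$ (j, i)" if "i < n" "j < n" for i j
    using max_trace_imp_symmetric[OF B max, of i j] that by (cases "i = j") auto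
  have sym: "transpose_mat B = B"
    by (rule eq_matI) (use B entry in auto)
  have "positive_semidefinite B"
    using max_trace_imp_psd_form[OF B max] B sym by (auto simp: positive_semidefinite_def)
  moreover have "B * B = A * transpose_mat A"
  proof -
    have "B * B = B * transpose_mat B" by (simp add: sym)
    also have "\<dots> = A * (Q * transpose_mat Q) * transpose_mat A"
      unfolding B_def using A Q(1)
      by (simp add: transpose_mult[of _ n n] assoc_mult_mat[of _ n n _ n _ n])
    also have "\<dots> = A * transpose_mat A" using A Q by simp
    finally show ?thesis .
  qed
  ultimately show thesis using that B by blast
qed

text \<open>Uniqueness resolves the definite description as soon as some root is exhibited.\<close>

lemma psd_sqrt_eqI:
  assumes "B \<in> carrier_mat n n" "positive_semidefinite B" "B * B = M"
  shows "psd_sqrt M = B"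
proof -
  have dim: "dim_row M = n" using assms(1,3) by auto
  show ?thesis
    unfolding psd_sqrt_def dim
  proof (rule the_equality)
    show "B \<in> carrier_mat n n \<and> positive_semidefinite B \<and> B * B = M"
      using assms by blast
    fix C assume "C \<in> carrier_mat n n \<and> positive_semidefinite C \<and> C * C = M"
    then show "C = B" using psd_square_root_unique[of C n B] assms by simp
  qed
qed

subsection \<open>Digraphs with in- and out-degrees at most one\<close>

lemma consecutive_pairs_subset: "consecutive_pairs xs \<subseteq> set xs \<times> set xs"
  by (auto simp: consecutive_pairs_def)

text \<open>Single-valuedness of the arc relation and of its converse expresses that out-degrees and
  in-degrees are at most one. It holds here because an entry of a distinct list determines its
  position.\<close>

lemma single_valued_consecutive_pairs:
  assumes "distinct xs"
  shows "single_valued (consecutive_pairs xs)" "single_valued ((consecutive_pairs xs)\<inverse>)"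
  using assms by (auto simp: single_valued_def consecutive_pairs_def nth_eq_iff_index_eq)

text \<open>Along the path the last vertex has no successor and the first one no predecessor, so the
  closing arc creates no conflict.\<close>

lemma single_valued_cycle:
  assumes "distinct xs" "xs \<noteq> []"
  shows "single_valued (consecutive_pairs xs \<union> {(last xs, hd xs)})"
    "single_valued ((consecutive_pairs xs \<union> {(last xs, hd xs)})\<inverse>)"
  using assms
  by (auto simp: single_valued_def consecutive_pairs_def nth_eq_iff_index_eq last_conv_nth hd_conv_nth)

definition path_cycle_or_vertex :: "'a pair_pre_digraph \<Rightarrow> bool" where
  "path_cycle_or_vertex H \<longleftrightarrow> is_directed_cycle H \<or> is_directed_path H \<or> is_isolated_vertex H"

lemma path_cycle_or_vertex_arcs:
  assumes "path_cycle_or_vertex H"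
  shows "pverts H \<noteq> {}" "parcs H \<subseteq> pverts H \<times> pverts H"
    "single_valued (parcs H)" "single_valued ((parcs H)\<inverse>)"
proof -
  \<comment> \<open>All three types are given by a nonempty distinct list, with or without the
    closing arc; an isolated vertex is the list with one entry.\<close>
  obtain xs where xs: "xs \<noteq> []" "distinct xs" "pverts H = set xs"
    "parcs H = consecutive_pairs xs \<or> parcs H = consecutive_pairs xs \<union> {(last xs, hd xs)}"
  proof -
    consider "is_directed_cycle H" | "is_directed_path H" | "is_isolated_vertex H"
      using assms by (auto simp: path_cycle_or_vertex_def)
    then show thesis
    proof cases
      case 1
      then obtain xs where "2 \<le> length xs" "distinct xs" "pverts H = set xs"
        "parcs H = consecutive_pairs xs \<union> {(last xs, hd xs)}"
        unfolding is_directed_cycle_def by blast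
      then show thesis by (intro that[of xs]) auto
    next
      case 2
      then obtain xs where "xs \<noteq> []" "distinct xs" "pverts H = set xs"
        "parcs H = consecutive_pairs xs"
        unfolding is_directed_path_def by blast
      then show thesis by (intro that[of xs]) auto
    next
      case 3
      then obtain v where "pverts H = {v}" "parcs H = {}" by (auto simp: is_isolated_vertex_def)
      then show thesis using that[of "[v]"] by (simp add: consecutive_pairs_def)
    qed
  qed
  have "parcs H \<subseteq> consecutive_pairs xs \<union> {(last xs, hd xs)}"
    using xs(4) by blast
  moreover have "(last xs, hd xs) \<in> set xs \<times> set xs" using xs(1) by simp
  ultimately show "parcs H \<subseteq> pverts H \<times> pverts H"
    using xs(3) consecutive_pairs_subset[of xs] by blast
  show "pverts H \<noteq> {}" using xs(1,3) by simp
  show "single_valued (parcs H)" "single_valued ((parcs H)\<inverse>)"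
    using xs(4) single_valued_consecutive_pairs[OF xs(2)] single_valued_cycle[OF xs(2,1)]
    by metis+
qed

text \<open>Two arcs with a common tail or a common head lie in members that share a vertex. By
  disjointness these members coincide, and the degree bound within that member applies.\<close>

lemma disjoint_union_single_valued:
  assumes "is_disjoint_union G \<H>" "\<And>H. H \<in> \<H> \<Longrightarrow> path_cycle_or_vertex H"
  shows "single_valued (parcs G)" "single_valued ((parcs G)\<inverse>)"
proof -
  have same: "H = K" if "H \<in> \<H>" "K \<in> \<H>" "v \<in> pverts H" "v \<in> pverts K" for H K v
    using assms(1) that unfolding is_disjoint_union_def pairwise_def disjnt_def by blast
  have arcs: "parcs G = (\<Union>H\<in>\<H>. parcs H)"
    using assms(1) by (simp add: is_disjoint_union_def)
  note deg = path_cycle_or_vertex_arcs[OF assms(2)]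
  show "single_valued (parcs G)"
  proof (rule single_valuedI)
    fix u v w assume "(u, v) \<in> parcs G" "(u, w) \<in> parcs G"
    then obtain H K where "H \<in> \<H>" "K \<in> \<H>" "(u, v) \<in> parcs H" "(u, w) \<in> parcs K"
      using arcs by auto
    moreover from this have "H = K" using same deg(2) by blast
    ultimately show "v = w" using deg(3) by (meson single_valuedD)
  qed
  show "single_valued ((parcs G)\<inverse>)"
  proof (rule single_valuedI)
    fix u v w assume "(u, v) \<in> (parcs G)\<inverse>" "(u, w) \<in> (parcs G)\<inverse>"
    then obtain H K where "H \<in> \<H>" "K \<in> \<H>" "(v, u) \<in> parcs H" "(w, u) \<in> parcs K"
      using arcs by auto
    moreover from this have "H = K" using same deg(2) by blast
    ultimately show "v = w" using deg(4) by (meson single_valuedD converseI)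
  qed
qed

section \<open>Splitting off longest paths\<close>

lemma consecutive_pairs_Cons:
  "consecutive_pairs (x # y # xs) = insert (x, y) (consecutive_pairs (y # xs))"
proof -
  have "e \<in> consecutive_pairs (x # y # xs)" if "e \<in> consecutive_pairs (y # xs)" for e
  proof -
    from that obtain i where "e = ((y # xs) ! i, (y # xs) ! Suc i)" "Suc i < length (y # xs)"
      by (auto simp: consecutive_pairs_def)
    then show ?thesis
      unfolding consecutive_pairs_def by (intro CollectI exI[of _ "Suc i"]) simp
  qed
  moreover have "(x, y) \<in> consecutive_pairs (x # y # xs)"
    by (force simp: consecutive_pairs_def)
  moreover have "e = (x, y) \<or> e \<in> consecutive_pairs (y # xs)"
    if "e \<in> consecutive_pairs (x # y # xs)" for e
  proof -
    from that obtain i where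
      "e = ((x # y # xs) ! i, (x # y # xs) ! Suc i)" "Suc i < length (x # y # xs)"
      by (auto simp: consecutive_pairs_def)
    then show ?thesis by (cases i) (auto simp: consecutive_pairs_def)
  qed
  ultimately show ?thesis by blast
qed

lemma consecutive_pairs_snoc:
  assumes "xs \<noteq> []"
  shows "consecutive_pairs (xs @ [x]) = insert (last xs, x) (consecutive_pairs xs)"
proof -
  have last: "(xs @ [x]) ! (length xs - 1) = last xs" "(xs @ [x]) ! Suc (length xs - 1) = x"
    using assms by (simp_all add: nth_append last_conv_nth)
  have "e \<in> consecutive_pairs (xs @ [x])" if "e \<in> consecutive_pairs xs" for e
  proof -
    from that obtain i where "e = (xs ! i, xs ! Suc i)" "Suc i < length xs"
      by (auto simp: consecutive_pairs_def)
    then show ?thesis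
      unfolding consecutive_pairs_def
      by (intro CollectI exI[of _ i]) (simp add: nth_append)
  qed
  moreover have "(last xs, x) \<in> consecutive_pairs (xs @ [x])"
    unfolding consecutive_pairs_def
    by (intro CollectI exI[of _ "length xs - 1"]) (use last assms in simp)
  moreover have "e = (last xs, x) \<or> e \<in> consecutive_pairs xs"
    if "e \<in> consecutive_pairs (xs @ [x])" for e
  proof -
    from that obtain i where
      i: "e = ((xs @ [x]) ! i, (xs @ [x]) ! Suc i)" "Suc i < length (xs @ [x])"
      by (auto simp: consecutive_pairs_def)
    show ?thesis
    proof (cases "Suc i < length xs")
      case True
      with i show ?thesis by (auto simp: consecutive_pairs_def nth_append)
    next
      case False
      with i have "i = length xs - 1" by simp
      with i(1) last show ?thesis by simp
    qed
  qed
  ultimately show ?thesis by blast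
qed

text \<open>A longest path cannot be extended at either end, so an arc leaving its last vertex ends
  on the path. It must end at the first vertex, since every other one already has its predecessor on
  the path; arcs into the first vertex are treated dually. The degree bounds make every other arc
  touching the path one of the path's own arcs.\<close>

lemma maximal_path_is_component:
  assumes E: "E \<subseteq> V \<times> V" "single_valued E" "single_valued (E\<inverse>)" "irrefl E"
    and xs: "xs \<noteq> []" "distinct xs" "set xs \<subseteq> V" "consecutive_pairs xs \<subseteq> E"
    and maximal: "\<And>ys. \<lbrakk>ys \<noteq> []; distinct ys; set ys \<subseteq> V; consecutive_pairs ys \<subseteq> E\<rbrakk>
      \<Longrightarrow> length ys \<le> length xs"
    and inside: "F = {(u, v) \<in> E. u \<in> set xs \<or> v \<in> set xs}"
  shows "F = consecutive_pairs xs \<or>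
    2 \<le> length xs \<and> F = consecutive_pairs xs \<union> {(last xs, hd xs)}"
proof -
  have last: "v = hd xs" if "(last xs, v) \<in> E" for v
  proof -
    have "v \<in> set xs"
    proof (rule ccontr)
      assume "v \<notin> set xs"
      then have "length (xs @ [v]) \<le> length xs"
        using that E xs by (intro maximal) (auto simp: consecutive_pairs_snoc)
      then show False by simp
    qed
    then obtain i where i: "i < length xs" "v = xs ! i" by (auto simp: in_set_conv_nth)
    show ?thesis
    proof (cases i)
      case 0 then show ?thesis using i xs by (simp add: hd_conv_nth)
    next
      case (Suc k)
      \<comment> \<open>Both \<open>xs ! k\<close> and \<open>last xs\<close> precede
        \<open>v\<close>, so they are equal. Distinctness then makes \<open>k\<close> the last
        index, although \<open>Suc k\<close> is still an index.\<close>
      then have "(xs ! k, v) \<in> E" using i xs by (auto simp: consecutive_pairs_def)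
      with that E have "xs ! k = last xs" by (meson single_valuedD converseI)
      with i Suc xs show ?thesis by (simp add: last_conv_nth nth_eq_iff_index_eq)
    qed
  qed
  have hd: "u = last xs" if "(u, hd xs) \<in> E" for u
  proof -
    have "u \<in> set xs"
    proof (rule ccontr)
      assume "u \<notin> set xs"
      then have "length (u # xs) \<le> length xs"
        using that E xs by (intro maximal) (auto simp: consecutive_pairs_Cons neq_Nil_conv)
      then show False by simp
    qed
    then obtain i where i: "i < length xs" "u = xs ! i" by (auto simp: in_set_conv_nth)
    show ?thesis
    proof (cases "Suc i < length xs")
      case True
      then have "(u, xs ! Suc i) \<in> E" using i xs by (auto simp: consecutive_pairs_def)
      with that E have "xs ! Suc i = hd xs" by (meson single_valuedD)
      with True xs show ?thesis by (simp add: hd_conv_nth nth_eq_iff_index_eq)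
    next
      case False
      with i have "i = length xs - 1" by simp
      with i xs show ?thesis by (simp add: last_conv_nth)
    qed
  qed
  have sub: "F \<subseteq> consecutive_pairs xs \<union> {(last xs, hd xs)}"
  proof
    fix e assume "e \<in> F"
    then obtain u v where e: "e = (u, v)" "(u, v) \<in> E" "u \<in> set xs \<or> v \<in> set xs"
      using inside by auto
    from e(3) show "e \<in> consecutive_pairs xs \<union> {(last xs, hd xs)}"
    proof
      assume "u \<in> set xs"
      then obtain i where i: "i < length xs" "u = xs ! i" by (auto simp: in_set_conv_nth)
      show ?thesis
      proof (cases "Suc i < length xs")
        case True
        then have c: "(u, xs ! Suc i) \<in> consecutive_pairs xs"
          using i by (auto simp: consecutive_pairs_def)
        with xs e E have "v = xs ! Suc i" by (meson single_valuedD subsetD)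
        with c e show ?thesis by simp
      next
        case False
        with i have "i = length xs - 1" by simp
        with i xs have "u = last xs" by (simp add: last_conv_nth)
        with last e show ?thesis by simp
      qed
    next
      assume "v \<in> set xs"
      then obtain i where i: "i < length xs" "v = xs ! i" by (auto simp: in_set_conv_nth)
      show ?thesis
      proof (cases i)
        case 0
        then have "v = hd xs" using i xs by (simp add: hd_conv_nth)
        with hd e show ?thesis by simp
      next
        case (Suc k)
        then have c: "(xs ! k, v) \<in> consecutive_pairs xs"
          using i by (auto simp: consecutive_pairs_def)
        with xs e E have "u = xs ! k" by (meson single_valuedD subsetD converseI)
        with c e show ?thesis by simp
      qed
    qed
  qed
  have sup: "consecutive_pairs xs \<subseteq> F"
    using xs consecutive_pairs_subset[of xs] inside by auto
  show ?thesis
  proof (cases "(last xs, hd xs) \<in> F")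
    case True
    \<comment> \<open>Absence of loops excludes a closing arc on a single vertex, which gives the
      minimal length two of a cycle.\<close>
    then have "last xs \<noteq> hd xs" using E inside by (auto simp: irrefl_def)
    then have "2 \<le> length xs" using xs by (cases xs; cases "tl xs") auto
    with True sub sup show ?thesis by auto
  qed (use sub sup in auto)
qed

text \<open>Induction on the vertex set: a longest path together with the set \<open>F\<close> of
  all arcs touching it is one component, and the remaining arcs live on the remaining
  vertices.\<close>

lemma single_valued_decomposition:
  assumes "finite V" "E \<subseteq> V \<times> V" "single_valued E" "single_valued (E\<inverse>)" "irrefl E"
  shows "\<exists>\<H>. is_disjoint_union \<lparr>pverts = V, parcs = E\<rparr> \<H> \<and> (\<forall>H\<in>\<H>. path_cycle_or_vertex H)"
  using assms
proof (induction V arbitrary: E rule: finite_psubset_induct)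
  case (psubset V E)
  show ?case
  proof (cases "V = {}")
    case True
    with psubset.prems show ?thesis
      by (intro exI[of _ "{}"]) (simp add: is_disjoint_union_def)
  next
    case False
    then obtain x where "x \<in> V" by auto
    define P where "P xs \<longleftrightarrow> xs \<noteq> [] \<and> distinct xs \<and> set xs \<subseteq> V \<and> consecutive_pairs xs \<subseteq> E" for xs
    have "P [x]" using \<open>x \<in> V\<close> by (simp add: P_def consecutive_pairs_def)
    \<comment> \<open>A distinct list in \<open>V\<close> has at most \<open>card V\<close> entries,
      so a longest path exists.\<close>
    moreover have "\<forall>xs. P xs \<longrightarrow> length xs < Suc (card V)"
      using psubset.hyps by (auto simp: P_def less_Suc_eq_le card_mono simp flip: distinct_card)
    ultimately obtain xs where xs: "P xs" "\<And>ys. P ys \<Longrightarrow> length ys \<le> length xs"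
      using ex_has_greatest_nat[of P "[x]" length "Suc (card V)"] by blast
    define F where "F = {(u, v) \<in> E. u \<in> set xs \<or> v \<in> set xs}"
    define H where "H = \<lparr>pverts = set xs, parcs = F\<rparr>"
    have F: "F = consecutive_pairs xs \<or>
      2 \<le> length xs \<and> F = consecutive_pairs xs \<union> {(last xs, hd xs)}"
      using psubset.prems xs F_def
      by (intro maximal_path_is_component[of E V]) (auto simp: P_def)
    then have H: "path_cycle_or_vertex H"
      using xs(1) by (auto simp: P_def H_def path_cycle_or_vertex_def is_directed_cycle_def
          is_directed_path_def)
    have V: "V - set xs \<subset> V" using xs(1) by (auto simp: P_def neq_Nil_conv)
    have "E - F \<subseteq> (V - set xs) \<times> (V - set xs)"
      using psubset.prems by (auto simp: F_def)
    moreover have "single_valued (E - F)" "single_valued ((E - F)\<inverse>)" "irrefl (E - F)"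
      using psubset.prems by (auto simp: single_valued_def irrefl_def)
    ultimately obtain \<H> where \<H>: "is_disjoint_union \<lparr>pverts = V - set xs, parcs = E - F\<rparr> \<H>"
      "\<forall>K\<in>\<H>. path_cycle_or_vertex K"
      using psubset.IH[OF V, of "E - F"] by blast
    have "pairwise (\<lambda>H K. disjnt (pverts H) (pverts K)) (insert H \<H>)"
      using \<H>(1) by (auto simp: is_disjoint_union_def pairwise_insert H_def disjnt_def)
    moreover have "V = (\<Union>K\<in>insert H \<H>. pverts K)"
      using \<H>(1) xs(1) by (auto simp: is_disjoint_union_def H_def P_def)
    moreover have "E = (\<Union>K\<in>insert H \<H>. parcs K)"
      using \<H>(1) by (auto simp: is_disjoint_union_def H_def F_def)
    ultimately show ?thesis
      using H \<H>(2) by (intro exI[of _ "insert H \<H>"]) (auto simp: is_disjoint_union_def)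
  qed
qed

subsection \<open>Energy and Randic index\<close>

lemma out_degree_eq_card: "out_degree (with_proj G) v = card {e \<in> parcs G. fst e = v}"
  by (simp add: out_degree_def out_arcs_def)

lemma in_degree_eq_card: "in_degree (with_proj G) w = card {e \<in> parcs G. snd e = w}"
  by (simp add: in_degree_def in_arcs_def)

lemma single_valued_iff_out_degree_le_1:
  assumes "finite (parcs G)"
  shows "single_valued (parcs G) \<longleftrightarrow> (\<forall>v. out_degree (with_proj G) v \<le> 1)"
proof -
  have "out_degree (with_proj G) v \<le> 1 \<longleftrightarrow>
    (\<forall>w w'. (v, w) \<in> parcs G \<longrightarrow> (v, w') \<in> parcs G \<longrightarrow> w = w')" for v
    unfolding out_degree_eq_card One_nat_def using assms
    by (subst card_le_Suc0_iff_eq) auto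
  then show ?thesis by (auto simp: single_valued_def)
qed

lemma single_valued_converse_iff_in_degree_le_1:
  assumes "finite (parcs G)"
  shows "single_valued ((parcs G)\<inverse>) \<longleftrightarrow> (\<forall>w. in_degree (with_proj G) w \<le> 1)"
proof -
  have "in_degree (with_proj G) w \<le> 1 \<longleftrightarrow>
    (\<forall>v v'. (v, w) \<in> parcs G \<longrightarrow> (v', w) \<in> parcs G \<longrightarrow> v = v')" for w
    unfolding in_degree_eq_card One_nat_def using assms
    by (subst card_le_Suc0_iff_eq) auto
  then show ?thesis by (auto simp: single_valued_def)
qed

lemma arc_degrees_pos:
  assumes "finite (parcs G)" "e \<in> parcs G"
  shows "0 < out_degree (with_proj G) (fst e)" "0 < in_degree (with_proj G) (snd e)"
  using assms by (cases e; auto simp: out_degree_eq_card in_degree_eq_card card_gt_0_iff)+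

lemma degree_le_max_degree:
  assumes "finite (pverts G)" "v \<in> pverts G"
  shows "out_degree (with_proj G) v \<le> max_degree G" "in_degree (with_proj G) v \<le> max_degree G"
  using assms by (auto simp: max_degree_def intro!: Max_ge)

lemma max_degree_leI:
  assumes "finite (pverts G)" "pverts G \<noteq> {}"
    and "\<And>v. v \<in> pverts G \<Longrightarrow> out_degree (with_proj G) v \<le> k"
    and "\<And>v. v \<in> pverts G \<Longrightarrow> in_degree (with_proj G) v \<le> k"
  shows "max_degree G \<le> k"
  using assms by (auto simp: max_degree_def)

section \<open>Degree sums and the Gram matrix of the adjacency matrix\<close>

lemma sum_nth_eq_sum_set:
  assumes "distinct xs"
  shows "(\<Sum>i<length xs. f (xs ! i)) = (\<Sum>x\<in>set xs. f x)"
  using assms by (intro sum.reindex_bij_betw bij_betw_nth) auto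

text \<open>Group the arcs by their tails: \<open>d\<close> arcs contribute
  \<open>1 / sqrt d\<close> each, hence \<open>sqrt d\<close> together. For \<open>d = 0\<close>
  both sides are \<open>0\<close>.\<close>

lemma sum_sqrt_out_degree:
  assumes "pair_digraph G"
  shows "(\<Sum>v\<in>pverts G. sqrt (out_degree (with_proj G) v)) =
    (\<Sum>e\<in>parcs G. 1 / sqrt (out_degree (with_proj G) (fst e)))"
proof -
  interpret pair_digraph G by fact
  let ?d = "\<lambda>v. real (out_degree (with_proj G) v)"
  have "(\<Sum>e\<in>{e \<in> parcs G. fst e = v}. 1 / sqrt (?d (fst e))) = sqrt (?d v)" for v
    by (simp add: out_degree_eq_card real_div_sqrt)
  moreover have "(\<Sum>v\<in>pverts G. \<Sum>e\<in>{e \<in> parcs G. fst e = v}. 1 / sqrt (?d (fst e))) =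
      (\<Sum>e\<in>parcs G. 1 / sqrt (?d (fst e)))"
    by (intro sum.group) (auto simp: pair_finite_verts pair_finite_arcs in_arcsD1)
  ultimately show ?thesis by simp
qed

text \<open>The sum counts the common out-neighbours of the two vertices.\<close>

lemma adjacency_gram_entry:
  assumes "i < length vs" "j < length vs"
  shows "(adjacency_mat vs G * transpose_mat (adjacency_mat vs G)) $$ (i, j) =
    (\<Sum>m<length vs. if (vs ! i, vs ! m) \<in> parcs G \<and> (vs ! j, vs ! m) \<in> parcs G then 1 else 0)"
  using assms
  by (auto simp: adjacency_mat_def scalar_prod_def lessThan_atLeast0 intro!: sum.cong)

lemma adjacency_gram_diag:
  assumes "pair_digraph G" "distinct vs" "set vs = pverts G" "i < length vs"
  shows "(adjacency_mat vs G * transpose_mat (adjacency_mat vs G)) $$ (i, i) =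
    out_degree (with_proj G) (vs ! i)"
proof -
  interpret pair_digraph G by fact
  have "(adjacency_mat vs G * transpose_mat (adjacency_mat vs G)) $$ (i, i) =
      (\<Sum>w\<in>pverts G. if (vs ! i, w) \<in> parcs G then 1 else 0)"
    using adjacency_gram_entry[OF assms(4,4)] assms(3)
      sum_nth_eq_sum_set[OF assms(2), of "\<lambda>w. if (vs ! i, w) \<in> parcs G then 1 else (0::real)"]
    by simp
  also have "\<dots> = card {w \<in> pverts G. (vs ! i, w) \<in> parcs G}"
    by (simp add: pair_finite_verts flip: sum.inter_filter)
  also have "card {w \<in> pverts G. (vs ! i, w) \<in> parcs G} = card {e \<in> parcs G. fst e = vs ! i}"
    by (rule bij_betw_same_card[of "Pair (vs ! i)"])
      (force simp: bij_betw_def inj_on_def dest: in_arcsD2)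
  finally show ?thesis by (simp add: out_degree_eq_card)
qed

text \<open>Exposes the root behind \<open>energy\<close>, so that later arguments rest only on the
  properties of \<open>B\<close> listed here.\<close>

lemma energy_eq_sum_diag:
  obtains B where "B \<in> carrier_mat (length vs) (length vs)" "positive_semidefinite B"
    "B * B = adjacency_mat vs G * transpose_mat (adjacency_mat vs G)"
    "energy vs G = (\<Sum>i<length vs. B $$ (i, i))"
proof -
  have "adjacency_mat vs G \<in> carrier_mat (length vs) (length vs)"
    by (simp add: adjacency_mat_def)
  then obtain B where B: "B \<in> carrier_mat (length vs) (length vs)" "positive_semidefinite B"
    "B * B = adjacency_mat vs G * transpose_mat (adjacency_mat vs G)"
    by (rule psd_square_root_exists)
  have "energy vs G = (\<Sum>i<length vs. B $$ (i, i))"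
    using B(1) unfolding energy_def psd_sqrt_eqI[OF B] mat_trace_def by simp
  with B that show thesis by blast
qed

section \<open>Diagonal of a symmetric matrix compared with that of its square\<close>

lemma symmetric_square_diag:
  fixes B :: "real mat"
  assumes "B \<in> carrier_mat n n" "transpose_mat B = B" "i < n"
  shows "(B * B) $$ (i, i) = (\<Sum>k<n. (B $$ (i, k))\<^sup>2)"
proof -
  have "B $$ (k, i) = B $$ (i, k)" if "k < n" for k
    using assms that by (metis index_transpose_mat(1) carrier_matD)
  then show ?thesis
    using assms(1,3) by (simp add: scalar_prod_def lessThan_atLeast0 power2_eq_square)
qed

lemma symmetric_diag_le_sqrt:
  fixes B :: "real mat"
  assumes "B \<in> carrier_mat n n" "transpose_mat B = B" "i < n"
  shows "B $$ (i, i) \<le> sqrt ((B * B) $$ (i, i))"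
proof (rule real_le_rsqrt)
  show "(B $$ (i, i))\<^sup>2 \<le> (B * B) $$ (i, i)"
    unfolding symmetric_square_diag[OF assms] using assms(3) by (intro member_le_sum) auto
qed

text \<open>The diagonal entry of \<open>B * B\<close> is the sum of the squares of row
  \<open>i\<close>. If the square of \<open>B $$ (i, i)\<close> already exhausts it, the other
  squares sum to zero.\<close>

lemma symmetric_diag_eq_sqrt_imp_row:
  fixes B :: "real mat"
  assumes "B \<in> carrier_mat n n" "transpose_mat B = B" "i < n"
    and "B $$ (i, i) = sqrt ((B * B) $$ (i, i))" and "k < n" "k \<noteq> i"
  shows "B $$ (i, k) = 0"
proof -
  have sq: "(B * B) $$ (i, i) = (\<Sum>k<n. (B $$ (i, k))\<^sup>2)"
    by (rule symmetric_square_diag) fact+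
  then have "(B * B) $$ (i, i) \<ge> 0" by (simp add: sum_nonneg)
  then have "(\<Sum>k<n. (B $$ (i, k))\<^sup>2) = (B $$ (i, i))\<^sup>2"
    using assms(4) sq by simp
  moreover have "(\<Sum>k<n. (B $$ (i, k))\<^sup>2) = (B $$ (i, i))\<^sup>2 + (\<Sum>k\<in>{..<n} - {i}. (B $$ (i, k))\<^sup>2)"
    using assms(3) by (intro sum.remove) auto
  ultimately have "(\<Sum>k\<in>{..<n} - {i}. (B $$ (i, k))\<^sup>2) = 0" by simp
  then show ?thesis using assms(5,6) by (subst (asm) sum_nonneg_eq_0_iff) auto
qed

text \<open>The right side is \<open>1 / sqrt d\<close> times
  \<open>sqrt (max_degree G / d')\<close>. The second factor is at least \<open>1\<close>, with
  equality only for \<open>d' = max_degree G\<close>.\<close>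

lemma randic_bound_term:
  assumes "pair_digraph G" "e \<in> parcs G"
  defines "d \<equiv> real (out_degree (with_proj G) (fst e))"
    and "d' \<equiv> real (in_degree (with_proj G) (snd e))"
  shows "1 / sqrt d \<le> sqrt (max_degree G) * (1 / sqrt (d * d'))"
    and "1 / sqrt d = sqrt (max_degree G) * (1 / sqrt (d * d')) \<Longrightarrow> d' = max_degree G"
proof -
  interpret pair_digraph G by fact
  have pos: "d > 0" "d' > 0"
    using arc_degrees_pos[OF pair_finite_arcs assms(2)] by (simp_all add: d_def d'_def)
  have "d' \<le> max_degree G"
    using degree_le_max_degree(2)[OF pair_finite_verts arc_snd_in_verts[OF assms(2)]]
    by (simp add: d'_def)
  then have "sqrt d' \<le> sqrt (max_degree G)" by simp
  then show "1 / sqrt d \<le> sqrt (max_degree G) * (1 / sqrt (d * d'))"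
    using pos by (simp add: real_sqrt_mult field_simps)
  assume "1 / sqrt d = sqrt (max_degree G) * (1 / sqrt (d * d'))"
  then have "sqrt d' = sqrt (max_degree G)"
    using pos by (simp add: real_sqrt_mult field_simps)
  then show "d' = max_degree G" by simp
qed

section \<open>Both directions of the equality criterion\<close>

lemma randic_index_scaled:
  "2 * sqrt (max_degree G) * randic_index G =
    (\<Sum>e\<in>parcs G. sqrt (max_degree G) * (1 / sqrt (real (out_degree (with_proj G) (fst e))
      * real (in_degree (with_proj G) (snd e)))))"
  by (simp add: randic_index_def sum_distrib_left case_prod_beta)

lemma energy_eq_imp_single_valued:
  assumes G: "pair_digraph G" and vs: "distinct vs" "set vs = pverts G"
    and eq: "energy vs G = 2 * sqrt (real (max_degree G)) * randic_index G"
  shows "single_valued (parcs G)" "single_valued ((parcs G)\<inverse>)"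
proof -
  interpret pair_digraph G by fact
  let ?n = "length vs"
  let ?out = "\<lambda>v. real (out_degree (with_proj G) v)"
  let ?in = "\<lambda>v. real (in_degree (with_proj G) v)"
  let ?M = "adjacency_mat vs G * transpose_mat (adjacency_mat vs G)"
  obtain B where B: "B \<in> carrier_mat ?n ?n" "positive_semidefinite B" "B * B = ?M"
    and energy: "energy vs G = (\<Sum>i<?n. B $$ (i, i))"
    by (rule energy_eq_sum_diag)
  have sym: "transpose_mat B = B" using B(2) by (simp add: positive_semidefinite_def)
  have diag: "(B * B) $$ (i, i) = ?out (vs ! i)" if "i < ?n" for i
    unfolding B(3) using adjacency_gram_diag[OF G vs that] .
  have diag_le: "B $$ (i, i) \<le> sqrt (?out (vs ! i))" if "i < ?n" for i
    using symmetric_diag_le_sqrt[OF B(1) sym that] diag[OF that] by simp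
  have "(\<Sum>i<?n. B $$ (i, i)) \<le> (\<Sum>i<?n. sqrt (?out (vs ! i)))"
    using diag_le by (intro sum_mono) simp
  moreover have "(\<Sum>i<?n. sqrt (?out (vs ! i))) = (\<Sum>e\<in>parcs G. 1 / sqrt (?out (fst e)))"
    using sum_nth_eq_sum_set[OF vs(1), of "\<lambda>v. sqrt (?out v)"] sum_sqrt_out_degree[OF G] vs(2)
    by simp
  moreover have "\<dots> \<le>
      (\<Sum>e\<in>parcs G. sqrt (max_degree G) * (1 / sqrt (?out (fst e) * ?in (snd e))))"
    using randic_bound_term(1)[OF G] by (intro sum_mono)
  \<comment> \<open>The assumed equality joins the two ends of the chain of inequalities, so both
    inequalities are equalities, and then they are so term by term.\<close>
  ultimately have sums: "(\<Sum>i<?n. B $$ (i, i)) = (\<Sum>i<?n. sqrt (?out (vs ! i)))"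
    "(\<Sum>e\<in>parcs G. 1 / sqrt (?out (fst e))) =
      (\<Sum>e\<in>parcs G. sqrt (max_degree G) * (1 / sqrt (?out (fst e) * ?in (snd e))))"
    using eq unfolding energy randic_index_scaled by linarith+
  have "B $$ (i, i) = sqrt (?out (vs ! i))" if "i < ?n" for i
    using sum_mono_inv[OF sums(1)] diag_le that by simp
  then have zero: "B $$ (i, k) = 0" if "i < ?n" "k < ?n" "k \<noteq> i" for i k
    using symmetric_diag_eq_sqrt_imp_row[OF B(1) sym] diag that by simp
  have M_zero: "?M $$ (i, j) = 0" if ij: "i < ?n" "j < ?n" "i \<noteq> j" for i j
  proof -
    have "?M $$ (i, j) = (\<Sum>k<?n. B $$ (i, k) * B $$ (k, j))"
      using B(1) ij unfolding B(3)[symmetric] by (simp add: scalar_prod_def lessThan_atLeast0)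
    also have "\<dots> = 0"
    proof (intro sum.neutral ballI)
      fix k assume "k \<in> {..<?n}"
      then show "B $$ (i, k) * B $$ (k, j) = 0"
        using zero[of i k] zero[of k j] ij by (cases "k = i") auto
    qed
    finally show ?thesis .
  qed
  show inj: "single_valued ((parcs G)\<inverse>)"
  proof (rule single_valuedI)
    fix w u v assume "(w, u) \<in> (parcs G)\<inverse>" "(w, v) \<in> (parcs G)\<inverse>"
    then have arcs: "(u, w) \<in> parcs G" "(v, w) \<in> parcs G" by auto
    then have "u \<in> set vs" "v \<in> set vs" "w \<in> set vs"
      using vs(2) in_arcsD1 in_arcsD2 by auto
    then obtain i j m where ijm: "i < ?n" "vs ! i = u" "j < ?n" "vs ! j = v" "m < ?n" "vs ! m = w"
      by (auto simp: in_set_conv_nth)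
    \<comment> \<open>The common out-neighbour \<open>w = vs ! m\<close> contributes a summand
      \<open>1\<close> to a sum of nonnegative terms.\<close>
    have "?M $$ (i, j) \<noteq> 0"
      unfolding adjacency_gram_entry[OF ijm(1,3)] using ijm arcs
      by (subst sum_nonneg_eq_0_iff) auto
    with M_zero ijm show "u = v" by auto
  qed
  show "single_valued (parcs G)"
  proof (cases "parcs G = {}")
    case False
    then obtain e where e: "e \<in> parcs G" by blast
    \<comment> \<open>A single arc suffices: equality in its term identifies the maximum degree with
      the in-degree of its head, already known to be at most one.\<close>
    have "1 / sqrt (?out (fst e)) =
        sqrt (max_degree G) * (1 / sqrt (?out (fst e) * ?in (snd e)))"
      using sum_mono_inv[OF sums(2) randic_bound_term(1)[OF G] e pair_finite_arcs] .
    then have "in_degree (with_proj G) (snd e) = max_degree G"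
      using randic_bound_term(2)[OF G e] by simp
    moreover have "in_degree (with_proj G) (snd e) \<le> 1"
      using inj single_valued_converse_iff_in_degree_le_1[OF pair_finite_arcs] by blast
    ultimately have max: "max_degree G \<le> 1" by simp
    have "out_degree (with_proj G) v \<le> 1" for v
    proof (cases "v \<in> pverts G")
      case True
      then show ?thesis
        using degree_le_max_degree(1)[OF pair_finite_verts] max by (meson le_trans)
    next
      case False
      then have "{e \<in> parcs G. fst e = v} = {}" by (auto dest: in_arcsD1)
      then show ?thesis unfolding out_degree_eq_card by (simp only: card.empty)
    qed
    then show ?thesis using single_valued_iff_out_degree_le_1[OF pair_finite_arcs] by blast
  qed simp
qed

lemma single_valued_imp_energy_eq:
  assumes G: "pair_digraph G" and vs: "distinct vs" "set vs = pverts G"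
    and sv: "single_valued (parcs G)" "single_valued ((parcs G)\<inverse>)"
  shows "energy vs G = 2 * sqrt (real (max_degree G)) * randic_index G"
proof -
  interpret pair_digraph G by fact
  let ?n = "length vs"
  define M where "M = adjacency_mat vs G * transpose_mat (adjacency_mat vs G)"
  have out_le: "out_degree (with_proj G) v \<le> 1" and in_le: "in_degree (with_proj G) v \<le> 1" for v
    using sv single_valued_iff_out_degree_le_1[OF pair_finite_arcs]
      single_valued_converse_iff_in_degree_le_1[OF pair_finite_arcs] by auto
  have M: "M \<in> carrier_mat ?n ?n"
    unfolding M_def by (rule mult_carrier_mat[of _ _ ?n]) (simp_all add: adjacency_mat_def)
  have M_entry: "M $$ (i, j) = (if i = j then out_degree (with_proj G) (vs ! i) else 0)"
    if ij: "i < ?n" "j < ?n" for i j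
  proof (cases "i = j")
    case True
    then show ?thesis using adjacency_gram_diag[OF G vs ij(1)] by (simp add: M_def)
  next
    case False
    \<comment> \<open>Different vertices with a common out-neighbour would give that neighbour
      in-degree two.\<close>
    then have "vs ! i \<noteq> vs ! j" using vs(1) ij by (simp add: nth_eq_iff_index_eq)
    then have "\<not> ((vs ! i, w) \<in> parcs G \<and> (vs ! j, w) \<in> parcs G)" for w
      using sv(2) by (meson single_valuedD converseI)
    then show ?thesis
      unfolding M_def adjacency_gram_entry[OF ij] using False by (auto intro!: sum.neutral)
  qed
  have "M * M = M"
  proof (rule eq_matI)
    fix i j assume "i < dim_row M" "j < dim_col M"
    then have ij: "i < ?n" "j < ?n" using M by auto
    have "(M * M) $$ (i, j) = (\<Sum>k<?n. M $$ (i, k) * M $$ (k, j))"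
      using M ij by (simp add: scalar_prod_def lessThan_atLeast0)
    also have "\<dots> = (\<Sum>k<?n. if k = i then M $$ (i, i) * M $$ (i, j) else 0)"
      using ij by (intro sum.cong) (auto simp: M_entry)
    also have "\<dots> = M $$ (i, i) * M $$ (i, j)" using ij by simp
    also have "\<dots> = M $$ (i, j)"
      using ij out_le[of "vs ! i"] by (auto simp: M_entry le_Suc_eq)
    finally show "(M * M) $$ (i, j) = M $$ (i, j)" .
  qed (use M in auto)
  moreover have "positive_semidefinite M"
    unfolding positive_semidefinite_def
  proof (intro conjI ballI)
    show "transpose_mat M = M"
      by (rule eq_matI) (use M M_entry in auto)
    fix x :: "real vec" assume "x \<in> carrier_vec (dim_row M)"
    then have x: "x \<in> carrier_vec ?n" using M by simp
    have "x $ i * M $$ (i, j) * x $ j \<ge> 0" if "i < ?n" "j < ?n" for i j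
    proof -
      have "x $ i * M $$ (i, j) * x $ j =
          (if i = j then out_degree (with_proj G) (vs ! i) * (x $ i)\<^sup>2 else 0)"
        using that by (simp add: M_entry power2_eq_square)
      then show ?thesis by simp
    qed
    then show "0 \<le> x \<bullet> (M *\<^sub>v x)"
      unfolding quadratic_form_sum[OF M x] by (intro sum_nonneg) auto
  qed
  ultimately have "psd_sqrt M = M" using M by (intro psd_sqrt_eqI)
  then have "energy vs G = (\<Sum>i<?n. real (out_degree (with_proj G) (vs ! i)))"
    using M M_entry by (simp add: energy_def mat_trace_def flip: M_def)
  also have "\<dots> = (\<Sum>v\<in>pverts G. real (out_degree (with_proj G) v))"
    using sum_nth_eq_sum_set[OF vs(1)] vs(2) by simp
  also have "\<dots> = (\<Sum>v\<in>pverts G. sqrt (out_degree (with_proj G) v))"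
  proof (rule sum.cong)
    fix v show "real (out_degree (with_proj G) v) = sqrt (out_degree (with_proj G) v)"
      using out_le[of v] by (auto simp: le_Suc_eq)
  qed simp
  also have "\<dots> = (\<Sum>e\<in>parcs G. 1 / sqrt (out_degree (with_proj G) (fst e)))"
    by (rule sum_sqrt_out_degree[OF G])
  also have "\<dots> = (\<Sum>e\<in>parcs G. sqrt (max_degree G)
      * (1 / sqrt (real (out_degree (with_proj G) (fst e)) * real (in_degree (with_proj G) (snd e)))))"
  proof (rule sum.cong)
    fix e assume e: "e \<in> parcs G"
    then have V: "fst e \<in> pverts G" by (rule arc_fst_in_verts)
    have "out_degree (with_proj G) (fst e) = 1" "in_degree (with_proj G) (snd e) = 1"
      using arc_degrees_pos[OF pair_finite_arcs e] out_le[of "fst e"] in_le[of "snd e"] by simp_all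
    \<comment> \<open>The tail of \<open>e\<close> shows that the vertex set is nonempty, so the
      maximum is at most one, and its out-degree shows that it is at least one. In a digraph without
      arcs both sums are empty, whatever value \<open>max_degree G\<close> has.\<close>
    moreover from this have "max_degree G = 1"
      using degree_le_max_degree(1)[OF pair_finite_verts V] V
        max_degree_leI[OF pair_finite_verts _ out_le in_le] by force
    ultimately show "1 / sqrt (out_degree (with_proj G) (fst e)) = sqrt (max_degree G)
      * (1 / sqrt (real (out_degree (with_proj G) (fst e)) * real (in_degree (with_proj G) (snd e))))"
      by simp
  qed simp
  finally show ?thesis unfolding randic_index_scaled .
qed

theorem theorem18:
  fixes G :: "'a pair_pre_digraph" and vs :: "'a list"
  assumes "pair_digraph G"
    and "distinct vs" and "set vs = pverts G"
  shows "energy vs G = 2 * sqrt (real (max_degree G)) * randic_index G \<longleftrightarrow>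
    (\<exists>\<H>. is_disjoint_union G \<H> \<and>
       (\<forall>H\<in>\<H>. is_directed_cycle H \<or> is_directed_path H \<or> is_isolated_vertex H))"
proof -
  interpret pair_digraph G by fact
  have "energy vs G = 2 * sqrt (real (max_degree G)) * randic_index G \<longleftrightarrow>
      single_valued (parcs G) \<and> single_valued ((parcs G)\<inverse>)"
    using energy_eq_imp_single_valued single_valued_imp_energy_eq assms by blast
  also have "\<dots> \<longleftrightarrow> (\<exists>\<H>. is_disjoint_union G \<H> \<and> (\<forall>H\<in>\<H>. path_cycle_or_vertex H))"
  proof
    assume "single_valued (parcs G) \<and> single_valued ((parcs G)\<inverse>)"
    moreover have "parcs G \<subseteq> pverts G \<times> pverts G" using in_arcsD1 in_arcsD2 by auto
    moreover have "irrefl (parcs G)" using pair_no_loops by (force simp: irrefl_def)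
    ultimately show "\<exists>\<H>. is_disjoint_union G \<H> \<and> (\<forall>H\<in>\<H>. path_cycle_or_vertex H)"
      using single_valued_decomposition[OF pair_finite_verts, of "parcs G"]
      by (simp add: is_disjoint_union_def)
  next
    assume "\<exists>\<H>. is_disjoint_union G \<H> \<and> (\<forall>H\<in>\<H>. path_cycle_or_vertex H)"
    then show "single_valued (parcs G) \<and> single_valued ((parcs G)\<inverse>)"
      using disjoint_union_single_valued by blast
  qed
  finally show ?thesis by (simp only: path_cycle_or_vertex_def)
qed

end
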